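(* Let $n$ be a composite positive integer for which there exists a positive integer $M$ with $M\,S_2(n) = \phi(n) - 1$, where $\phi$ is Euler's totient function and $S_2(n) = n\prod_{p \mid n}\left(1 - \frac{2}{p}\right)$. Let $K = \omega(n)$ be the number of distinct prime divisors of $n$. Then $$n < 2^{2^K + K} - 2^{2^{K-1} + K}.$$
   Context: $S_2$ is Schemmel's totient function, $S_2(n) = n\prod_{p\mid n}(1-2/p)$, the product being over the distinct primes dividing $n$. Such $n$ are called Deaconescu numbers. *)

theory Defs
  imports "HOL-Number_Theory.Number_Theory" Complex_Main
begin

definition schemmel2 :: "nat \<Rightarrow> real"
  where "schemmel2 n = real n * (\<Prod>p\<in>prime_factors n. 1 - 2 / real p)"

end

(* Put d_i = p_i - 1 over the primes p_i dividing n. The equation forces n to be odd and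
   squarefree, and it makes the product of the 1 - 1/d_i fall below 1/M only when the last
   factor is included. Nielsen's bound for such crossings gives
   totient n <= 2^(2^K) - 2^(2^(K-1)), and n < 2^K * totient n because p < 2(p - 1) for odd p.

   Nielsen's bound compares an increasing sequence x with the doubly exponential extremal one.
   If some proper initial product of x is small, those factors are absorbed into a and one inducts.
   Otherwise all initial products of x are large, and if the bound failed, log-majorisation would
   make the product of the 1 - 1/x_i exceed a/(a+1), which is at least a/b. *)
theory Submission
  imports Defs
begin

section \<open>Log-majorisation for products of \<open>1 - 1 / x i\<close>\<close>

text \<open>Summation by parts: with partial sums \<open>S k\<close> of \<open>D\<close>, the right
  side minus the left is the sum over \<open>i < m\<close> of
  \<open>(c i - c (Suc i)) * S (Suc i)\<close>, and every term is nonnegative.\<close>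

lemma abel_sum_ge:
  fixes c D :: "nat \<Rightarrow> real"
  assumes "\<And>i. i < m \<Longrightarrow> c (Suc i) \<le> c i"
    and "\<And>k. k \<le> m \<Longrightarrow> 0 \<le> (\<Sum>i<k. D i)"
  shows "c m * (\<Sum>i<Suc m. D i) \<le> (\<Sum>i<Suc m. c i * D i)"
  using assms
proof (induction m)
  case 0
  then show ?case by simp
next
  case (Suc m)
  have "c (Suc m) * (\<Sum>i<Suc m. D i) \<le> c m * (\<Sum>i<Suc m. D i)"
    using Suc.prems(1)[of m] Suc.prems(2)[of "Suc m"] by (intro mult_right_mono) auto
  also have "\<dots> \<le> (\<Sum>i<Suc m. c i * D i)"
    using Suc.prems by (intro Suc.IH) auto
  finally show ?case by (simp add: distrib_left)
qed

text \<open>The tangent line inequality at \<open>x\<close> for \<open>ln (1 - 1 / x)\<close>, a concave function of \<open>ln x\<close>.\<close>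

lemma ln_one_minus_inverse_diff_ge:
  fixes x z :: real
  assumes "1 < x" "1 < z"
  shows "1 / (x - 1) * (ln x - ln z) \<le> ln (1 - 1 / x) - ln (1 - 1 / z)"
proof -
  let ?q = "(1 - 1 / z) / (1 - 1 / x)"
  have pos: "0 < 1 - 1 / x" "0 < 1 - 1 / z"
    using assms by auto
  \<comment> \<open>The bound \<open>ln t \<le> t - 1\<close> is used at \<open>t = ?q\<close> and
    \<open>t = x / z\<close>; the weight \<open>x - 1\<close> makes the two right-hand sides
    cancel.\<close>
  have "(x - 1) * ln ?q + ln (x / z) \<le> (x - 1) * (?q - 1) + (x / z - 1)"
    using assms pos by (intro add_mono mult_left_mono ln_le_minus_one) auto
  also have "\<dots> = 0"
    using assms by (simp add: field_simps)
  finally have "(x - 1) * (ln (1 - 1 / z) - ln (1 - 1 / x)) + (ln x - ln z) \<le> 0"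
    using assms pos by (simp add: ln_div)
  then show ?thesis
    using assms by (simp add: field_simps)
qed

text \<open>After taking logarithms, the tangents at the points \<open>x i\<close> have slopes
  \<open>1 / (x i - 1)\<close>, which monotonicity of \<open>x\<close> makes nonincreasing. Abel
  summation then transfers the comparison of partial products.\<close>

lemma prod_one_minus_inverse_less:
  fixes x z :: "nat \<Rightarrow> real"
  assumes x: "\<And>i. i \<le> m \<Longrightarrow> 1 < x i" and z: "\<And>i. i \<le> m \<Longrightarrow> 1 < z i"
    and mono: "\<And>i. i < m \<Longrightarrow> x i \<le> x (Suc i)"
    and le: "\<And>k. k \<le> m \<Longrightarrow> (\<Prod>i<k. z i) \<le> (\<Prod>i<k. x i)"
    and less: "(\<Prod>i<Suc m. z i) < (\<Prod>i<Suc m. x i)"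
  shows "(\<Prod>i<Suc m. 1 - 1 / z i) < (\<Prod>i<Suc m. 1 - 1 / x i)"
proof -
  define D where "D i = ln (x i) - ln (z i)" for i
  have x0: "0 < x i" and z0: "0 < z i" if "i \<le> m" for i
    using x[OF that] z[OF that] by auto
  have D: "(\<Sum>i<k. D i) = ln (\<Prod>i<k. x i) - ln (\<Prod>i<k. z i)" if "k \<le> Suc m" for k
  proof -
    have "(\<Sum>i<k. ln (x i)) = ln (\<Prod>i<k. x i)" "(\<Sum>i<k. ln (z i)) = ln (\<Prod>i<k. z i)"
      using that by (auto intro!: ln_prod [symmetric] simp: less_imp_neq [OF x0, symmetric] less_imp_neq [OF z0, symmetric])
    then show ?thesis by (simp add: D_def sum_subtractf)
  qed
  have pz: "0 < (\<Prod>i<k. z i)" if "k \<le> Suc m" for k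
    using that by (intro prod_pos z0) auto
  have D_nonneg: "0 \<le> (\<Sum>i<k. D i)" if "k \<le> m" for k
  proof -
    have "ln (\<Prod>i<k. z i) \<le> ln (\<Prod>i<k. x i)"
      using pz[of k] le[OF that] that by (intro ln_mono) auto
    then show ?thesis using D[of k] that by simp
  qed
  have D_pos: "0 < (\<Sum>i<Suc m. D i)"
  proof -
    have "ln (\<Prod>i<Suc m. z i) < ln (\<Prod>i<Suc m. x i)"
      using pz[of "Suc m"] less by (intro ln_strict_mono) auto
    then show ?thesis using D[of "Suc m"] by simp
  qed
  \<comment> \<open>Strictness enters here, through the full products.\<close>
  have "0 < 1 / (x m - 1) * (\<Sum>i<Suc m. D i)"
    using D_pos x[of m] by (intro mult_pos_pos) auto
  also have "\<dots> \<le> (\<Sum>i<Suc m. 1 / (x i - 1) * D i)"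
  proof (rule abel_sum_ge)
    show "1 / (x (Suc i) - 1) \<le> 1 / (x i - 1)" if "i < m" for i
      using mono[OF that] x[of i] that by (intro divide_left_mono mult_pos_pos) auto
  qed (rule D_nonneg)
  also have "\<dots> \<le> (\<Sum>i<Suc m. ln (1 - 1 / x i) - ln (1 - 1 / z i))"
    unfolding D_def using x z by (intro sum_mono ln_one_minus_inverse_diff_ge) auto
  also have "\<dots> = ln (\<Prod>i<Suc m. 1 - 1 / x i) - ln (\<Prod>i<Suc m. 1 - 1 / z i)"
  proof -
    have "(\<Sum>i<Suc m. ln (1 - 1 / x i)) = ln (\<Prod>i<Suc m. 1 - 1 / x i)"
      "(\<Sum>i<Suc m. ln (1 - 1 / z i)) = ln (\<Prod>i<Suc m. 1 - 1 / z i)"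
      using x0 z0 by (auto intro!: ln_prod [symmetric]
        simp: less_Suc_eq_le less_imp_neq [OF x, symmetric] less_imp_neq [OF z, symmetric] simp del: prod.lessThan_Suc sum.lessThan_Suc)
    then show ?thesis by (simp only: sum_subtractf)
  qed
  finally have "ln (\<Prod>i<Suc m. 1 - 1 / z i) < ln (\<Prod>i<Suc m. 1 - 1 / x i)"
    by simp
  moreover have "0 < (\<Prod>i<Suc m. 1 - 1 / z i)" "0 < (\<Prod>i<Suc m. 1 - 1 / x i)"
    using x z x0 z0 by (auto intro!: prod_pos simp: less_Suc_eq_le simp del: prod.lessThan_Suc)
  ultimately show ?thesis by (simp only: ln_less_cancel_iff)
qed

section \<open>Identities for the doubly exponential extremal sequence\<close>

text \<open>Repeated difference of squares, starting from the factor \<open>A - 1\<close>.\<close>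

lemma prod_double_power_plus_one:
  fixes A :: "'a :: comm_ring_1"
  shows "(A - 1) * (\<Prod>i<m. A ^ 2 ^ i + 1) = A ^ 2 ^ m - 1"
proof (induction m)
  case 0
  then show ?case by simp
next
  case (Suc m)
  have "(A - 1) * (\<Prod>i<Suc m. A ^ 2 ^ i + 1) = (A ^ 2 ^ m - 1) * (A ^ 2 ^ m + 1)"
    using Suc.IH by (simp add: mult.assoc [symmetric])
  then show ?case
    by (simp add: power_mult power2_eq_square algebra_simps)
qed

text \<open>Telescopes by \<open>(1 - 1 / (y + 1)) * (1 - 1 / y ^ 2) = 1 - 1 / y\<close>. The
  separate factor belongs to the lowered last term of the extremal sequence.\<close>

lemma prod_one_minus_inverse_double_power:
  fixes A :: real
  assumes "1 < A"
  shows "(\<Prod>i<m. 1 - 1 / (A ^ 2 ^ i + 1)) * (1 - 1 / A ^ 2 ^ m) = 1 - 1 / A"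
proof (induction m)
  case 0
  then show ?case by simp
next
  case (Suc m)
  define y where "y = A ^ 2 ^ m"
  have "0 < y" using assms by (simp add: y_def)
  then have "(1 - 1 / (y + 1)) * (1 - 1 / y ^ 2) = 1 - 1 / y"
    by (simp add: divide_simps) (simp add: algebra_simps power2_eq_square)
  moreover have "A ^ 2 ^ Suc m = y ^ 2"
    by (simp add: y_def power_mult [symmetric] mult.commute)
  ultimately show ?case
    using Suc.IH by (simp add: y_def mult.assoc)
qed

section \<open>Nielsen's bound\<close>

lemma prod_lessThan_add:
  fixes f :: "nat \<Rightarrow> 'a :: comm_monoid_mult"
  shows "(\<Prod>i<k + m. f i) = (\<Prod>i<k. f i) * (\<Prod>i<m. f (k + i))"
  by (induction m) (simp_all add: mult.assoc)

text \<open>Monotonicity of \<open>t ^ 2 - t\<close>, written with sums to avoid truncated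
  subtraction. The bound for a shortened sequence has this shape.\<close>

lemma diff_square_mono:
  fixes x y :: nat
  assumes "1 \<le> x" "x \<le> y"
  shows "x ^ 2 + y \<le> y ^ 2 + x"
proof -
  obtain d where "y = x + d" using assms le_Suc_ex by blast
  then show ?thesis using assms(1)
    by (cases x) (simp_all add: power2_eq_square algebra_simps)
qed

text \<open>The extremal sequence is \<open>z\<^sub>i = (a + 1) ^ 2 ^ i + 1\<close>, with the last term lowered by one:
  its product is the bound divided by \<open>a\<close>, and the factors \<open>1 - 1 / z\<^sub>i\<close> multiply to exactly
  \<open>a / (a + 1)\<close>.\<close>

lemma prod_le_if_partial_prods_large:
  fixes x :: "nat \<Rightarrow> nat" and a b :: nat
  assumes "1 \<le> a" "a < b"
    and x: "\<And>i. i \<le> m \<Longrightarrow> 2 \<le> x i" and mono: "\<And>i. i < m \<Longrightarrow> x i \<le> x (Suc i)"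
    and le: "b * (\<Prod>i<Suc m. x i - 1) \<le> a * (\<Prod>i<Suc m. x i)"
    and large: "\<And>k. 1 \<le> k \<Longrightarrow> k \<le> m \<Longrightarrow> (a + 1) ^ 2 ^ k \<le> a * (\<Prod>i<k. x i)"
  shows "a * (\<Prod>i<Suc m. x i) + (a + 1) ^ 2 ^ m \<le> (a + 1) ^ 2 ^ Suc m"
proof (rule ccontr)
  assume "\<not> ?thesis"
  then have "(a + 1) ^ 2 ^ Suc m < a * (\<Prod>i<Suc m. x i) + (a + 1) ^ 2 ^ m"
    by linarith
  then have "real ((a + 1) ^ 2 ^ Suc m) < real (a * (\<Prod>i<Suc m. x i) + (a + 1) ^ 2 ^ m)"
    by (simp only: of_nat_less_iff)
  moreover define A where "A = real a + 1"
  ultimately have gt: "A ^ 2 ^ Suc m - A ^ 2 ^ m < real a * (\<Prod>i<Suc m. real (x i))"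
    by (simp add: add.commute)
  have A: "1 < A" and a: "real a = A - 1" "0 < real a"
    using \<open>1 \<le> a\<close> by (auto simp: A_def)
  define z where "z i = (if i < m then A ^ 2 ^ i + 1 else A ^ 2 ^ m)" for i
  have A_pow: "1 < A ^ 2 ^ i" for i
    using A by (intro one_less_power) auto
  have prod_z: "real a * (\<Prod>i<k. z i) = A ^ 2 ^ k - 1" if "k \<le> m" for k
    using that prod_double_power_plus_one[of A k] by (simp add: z_def a)
  have "(\<Prod>i<Suc m. 1 - 1 / z i) < (\<Prod>i<Suc m. 1 - 1 / real (x i))"
  proof (rule prod_one_minus_inverse_less)
    show "1 < real (x i)" if "i \<le> m" for i using x[OF that] by simp
    show "1 < z i" if "i \<le> m" for i
      using A_pow[of i] A_pow[of m] by (simp add: z_def)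
    show "real (x i) \<le> real (x (Suc i))" if "i < m" for i using mono[OF that] by simp
    show "(\<Prod>i<k. z i) \<le> (\<Prod>i<k. real (x i))" if "k \<le> m" for k
    \<comment> \<open>The assumption \<open>large\<close> starts at \<open>k = 1\<close>, since at
      \<open>k = 0\<close> it would read \<open>a + 1 \<le> a\<close>. For \<open>k \<ge> 1\<close>
      it exceeds by one what is required here.\<close>
    proof (cases "k = 0")
      case False
      then have "real ((a + 1) ^ 2 ^ k) \<le> real (a * (\<Prod>i<k. x i))"
        using large[of k] that by (simp only: of_nat_le_iff)
      then have "real a * (\<Prod>i<k. z i) \<le> real a * (\<Prod>i<k. real (x i))"
        using prod_z[OF that] by (simp add: A_def add.commute)
      then show ?thesis using a by simp
    qed simp
    have "real a * (\<Prod>i<Suc m. z i) = (real a * (\<Prod>i<m. z i)) * A ^ 2 ^ m"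
      by (simp add: z_def)
    also have "\<dots> = A ^ 2 ^ Suc m - A ^ 2 ^ m"
      by (simp only: prod_z) (simp add: power_mult power2_eq_square algebra_simps)
    finally have "real a * (\<Prod>i<Suc m. z i) < real a * (\<Prod>i<Suc m. real (x i))"
      using gt by simp
    then show "(\<Prod>i<Suc m. z i) < (\<Prod>i<Suc m. real (x i))"
      using a by (simp only: mult_less_cancel_left_pos)
  qed
  also have "(\<Prod>i<Suc m. 1 - 1 / z i) = 1 - 1 / A"
    using prod_one_minus_inverse_double_power[OF A, of m] by (simp add: z_def)
  also have "(\<Prod>i<Suc m. 1 - 1 / real (x i)) = (\<Prod>i<Suc m. real (x i - 1) / real (x i))"
  proof (rule prod.cong)
    fix i assume "i \<in> {..<Suc m}"
    then show "1 - 1 / real (x i) = real (x i - 1) / real (x i)"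
      using x[of i] by (simp add: of_nat_diff field_simps)
  qed simp
  also have "\<dots> = real (\<Prod>i<Suc m. x i - 1) / real (\<Prod>i<Suc m. x i)"
    by (simp only: prod_dividef of_nat_prod)
  finally have *: "1 - 1 / A < real (\<Prod>i<Suc m. x i - 1) / real (\<Prod>i<Suc m. x i)" .
  have X: "0 < (\<Prod>i<Suc m. x i)"
    using x by (intro prod_pos) (auto simp: less_Suc_eq_le intro: less_le_trans[of 0 2])
  define X Y where "X = real (\<Prod>i<Suc m. x i)" and "Y = real (\<Prod>i<Suc m. x i - 1)"
  have "1 - 1 / A < Y / X" "0 < X"
    using * X unfolding X_def Y_def by (simp_all only: of_nat_0_less_iff)
  then have "X * (A - 1) < A * Y"
    using A by (simp add: field_simps)
  then have "real (a * (\<Prod>i<Suc m. x i)) < real ((a + 1) * (\<Prod>i<Suc m. x i - 1))"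
    by (simp only: A_def X_def Y_def of_nat_mult of_nat_add of_nat_1) (simp add: mult_ac)
  then have "a * (\<Prod>i<Suc m. x i) < (a + 1) * (\<Prod>i<Suc m. x i - 1)"
    by (simp only: of_nat_less_iff)
  \<comment> \<open>Integrality turns \<open>a < b\<close> into
    \<open>a + 1 \<le> b\<close>.\<close>
  also have "\<dots> \<le> b * (\<Prod>i<Suc m. x i - 1)"
    using \<open>a < b\<close> by (intro mult_right_mono) auto
  finally show False using le by simp
qed

text \<open>The product of the \<open>1 - 1 / x i\<close> is above \<open>a / b\<close> before the
  factor at \<open>m\<close> and at most \<open>a / b\<close> after it. Moving an initial segment
  into \<open>a\<close> and \<open>b\<close> preserves this crossing, hence strong induction on
  \<open>m\<close> with \<open>a\<close>, \<open>b\<close> and \<open>x\<close> arbitrary.\<close>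

lemma prod_le_of_fraction_crossing:
  fixes x :: "nat \<Rightarrow> nat" and a b :: nat
  assumes "1 \<le> a"
    and "\<And>i. i \<le> m \<Longrightarrow> 2 \<le> x i" and "\<And>i. i < m \<Longrightarrow> x i \<le> x (Suc i)"
    and "b * (\<Prod>i<Suc m. x i - 1) \<le> a * (\<Prod>i<Suc m. x i)"
    and "a * (\<Prod>i<m. x i) < b * (\<Prod>i<m. x i - 1)"
  shows "a * (\<Prod>i<Suc m. x i) + (a + 1) ^ 2 ^ m \<le> (a + 1) ^ 2 ^ Suc m"
  using assms
proof (induction m arbitrary: a b x rule: less_induct)
  case (less m)
  show ?case
  proof (cases "\<exists>k. 1 \<le> k \<and> k \<le> m \<and> a * (\<Prod>i<k. x i) < (a + 1) ^ 2 ^ k")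
    case True
    then obtain k where k: "1 \<le> k" "k \<le> m" "a * (\<Prod>i<k. x i) < (a + 1) ^ 2 ^ k"
      by blast
    define l where "l = m - k"
    have m: "m = k + l" "Suc m = k + Suc l" using k by (auto simp: l_def)
    define a' where "a' = a * (\<Prod>i<k. x i)"
    define b' where "b' = b * (\<Prod>i<k. x i - 1)"
    have "a' * (\<Prod>i<Suc l. x (k + i)) + (a' + 1) ^ 2 ^ l \<le> (a' + 1) ^ 2 ^ Suc l"
    proof (rule less.IH)
      show "l < m" using k by (simp add: l_def)
      have "0 < (\<Prod>i<k. x i)"
        using less.prems(2) k by (intro prod_pos) (force intro: less_le_trans[of 0 2])
      then show "1 \<le> a'" using less.prems(1) by (simp add: a'_def Suc_le_eq)
      show "2 \<le> x (k + i)" if "i \<le> l" for i using that less.prems(2) m by simp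
      show "x (k + i) \<le> x (k + Suc i)" if "i < l" for i
        using that less.prems(3)[of "k + i"] m by simp
      show "b' * (\<Prod>i<Suc l. x (k + i) - 1) \<le> a' * (\<Prod>i<Suc l. x (k + i))"
        using less.prems(4) unfolding m(2) prod_lessThan_add a'_def b'_def by (simp only: mult.assoc)
      show "a' * (\<Prod>i<l. x (k + i)) < b' * (\<Prod>i<l. x (k + i) - 1)"
        using less.prems(5) unfolding m(1) prod_lessThan_add a'_def b'_def by (simp only: mult.assoc)
    qed
    moreover define u where "u = (a' + 1) ^ 2 ^ l"
    moreover define v where "v = (a + 1) ^ 2 ^ m"
    moreover have "u ^ 2 + v \<le> v ^ 2 + u"
    proof (rule diff_square_mono)
      show "1 \<le> u" by (simp add: u_def)
      \<comment> \<open>Smallness of the absorbed segment means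
        \<open>a' + 1 \<le> (a + 1) ^ 2 ^ k\<close>.\<close>
      have "u \<le> ((a + 1) ^ 2 ^ k) ^ 2 ^ l"
        unfolding u_def using k(3) by (intro power_mono) (auto simp: a'_def)
      also have "\<dots> = v" by (simp only: v_def m power_mult [symmetric] power_add)
      finally show "u \<le> v" .
    qed
    moreover have "(a' + 1) ^ 2 ^ Suc l = u ^ 2" "(a + 1) ^ 2 ^ Suc m = v ^ 2"
      by (simp_all only: u_def v_def power_mult [symmetric] power_Suc2)
    moreover have "a' * (\<Prod>i<Suc l. x (k + i)) = a * (\<Prod>i<Suc m. x i)"
      unfolding m(2) prod_lessThan_add a'_def by (simp only: mult.assoc)
    ultimately show ?thesis by linarith
  next
    case False
    \<comment> \<open>The crossing forces \<open>a < b\<close>: the fraction \<open>a / b\<close>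
      lies below a product of factors at most 1.\<close>
    have "(\<Prod>i<m. x i - 1) \<le> (\<Prod>i<m. x i)" by (intro prod_mono) auto
    then have "a * (\<Prod>i<m. x i) < b * (\<Prod>i<m. x i)"
      using less.prems(5) mult_left_mono[of _ _ b] by (meson le0 less_le_trans)
    then have "a < b" by simp
    with less.prems False show ?thesis
      by (intro prod_le_if_partial_prods_large[where b = b]) (auto simp: not_less)
  qed
qed

section \<open>Deaconescu numbers\<close>

text \<open>The cofactor of the radical divides both \<open>M * schemmel2 n\<close> and \<open>totient n\<close>, hence divides 1.\<close>

lemma deaconescu_squarefree:
  fixes n M :: nat
  assumes n: "n > 1" "\<not> prime n" and eq: "real M * schemmel2 n = real (totient n) - 1"
  shows "n = \<Prod>(prime_factors n)" "odd n"
    "M * (\<Prod>p\<in>prime_factors n. p - 2) + 1 = (\<Prod>p\<in>prime_factors n. p - 1)"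
proof -
  let ?P = "prime_factors n"
  have p2: "2 \<le> p" if "p \<in> ?P" for p
    using that by (auto dest: prime_ge_2_nat simp: in_prime_factors_iff)
  show "odd n"
  \<comment> \<open>For even \<open>n\<close> the factor at 2 vanishes, so
    \<open>totient n = 1\<close>; but \<open>n\<close> is not prime, hence
    \<open>n > 2\<close>.\<close>
  proof
    assume "even n"
    then have "2 \<in> ?P" using n by (auto simp: in_prime_factors_iff)
    then have "schemmel2 n = 0" unfolding schemmel2_def by (auto simp: prod_zero_iff intro!: bexI[of _ 2])
    then have "totient n = 1" using eq by simp
    moreover have "n > 2" using n by (cases "n = 2") auto
    ultimately show False using totient_gt_1[of n] by simp
  qed
  have "\<Prod>?P dvd (\<Prod>p\<in>?P. p ^ multiplicity p n)"
    by (intro prod_dvd_prod dvd_power) (auto simp: prime_factors_multiplicity)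
  also have "\<dots> = n" using n by (intro prime_factorization_nat [symmetric]) auto
  finally obtain R where R: "n = \<Prod>?P * R" by (auto elim: dvdE)
  \<comment> \<open>One computation serves \<open>totient\<close> (\<open>c = 1\<close>) and
    \<open>schemmel2\<close> (\<open>c = 2\<close>); natural subtraction is exact because
    \<open>p \<ge> 2\<close>.\<close>
  have scale: "real n * (\<Prod>p\<in>?P. 1 - real c / real p) = real (R * (\<Prod>p\<in>?P. p - c))"
    if "c \<le> 2" for c
  proof -
    have "(\<Prod>p\<in>?P. 1 - real c / real p) = (\<Prod>p\<in>?P. real (p - c) / real p)"
    proof (rule prod.cong)
      fix p assume "p \<in> ?P"
      from p2[OF this] that show "1 - real c / real p = real (p - c) / real p"
        by (simp add: of_nat_diff field_simps)
    qed simp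
    also have "\<dots> = real (\<Prod>p\<in>?P. p - c) / real (\<Prod>?P)"
      by (simp add: prod_dividef)
    finally have *: "(\<Prod>p\<in>?P. 1 - real c / real p) = real (\<Prod>p\<in>?P. p - c) / real (\<Prod>?P)" .
    have "real (\<Prod>?P) \<noteq> 0" using p2 by (force simp: prod_zero_iff)
    moreover have "real n = real (\<Prod>?P) * real R" using R by (metis of_nat_mult)
    ultimately show ?thesis unfolding * by (simp del: of_nat_prod)
  qed
  have "schemmel2 n = real (R * (\<Prod>p\<in>?P. p - 2))"
    using scale[of 2] by (simp add: schemmel2_def)
  moreover have "real (totient n) = real (R * (\<Prod>p\<in>?P. p - 1))"
    using scale[of 1] by (simp add: totient_formula2)
  ultimately have "real (M * (R * (\<Prod>p\<in>?P. p - 2)) + 1) = real (R * (\<Prod>p\<in>?P. p - 1))"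
    using eq by (simp only: of_nat_mult of_nat_add)
  then have main: "M * (R * (\<Prod>p\<in>?P. p - 2)) + 1 = R * (\<Prod>p\<in>?P. p - 1)"
    by (simp only: of_nat_eq_iff)
  have "R dvd M * (R * (\<Prod>p\<in>?P. p - 2))" "R dvd M * (R * (\<Prod>p\<in>?P. p - 2)) + 1"
    unfolding main by simp_all
  then have "R dvd 1" by (simp only: dvd_add_right_iff)
  then have "R = 1" by simp
  then show "n = \<Prod>?P" "M * (\<Prod>p\<in>?P. p - 2) + 1 = (\<Prod>p\<in>?P. p - 1)"
    using R main by simp_all
qed

theorem theorem1p2:
  fixes n K :: nat
  assumes "n > 1" and "\<not> prime n"
    and "\<exists>M::nat. M > 0 \<and> real M * schemmel2 n = real (totient n) - 1"
    and "K = card (prime_factors n)"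
  shows "real n < 2 ^ (2 ^ K + K) - 2 ^ (2 ^ (K - 1) + K)"
proof -
  let ?P = "prime_factors n"
  obtain M where M: "M > 0" "real M * schemmel2 n = real (totient n) - 1"
    using assms(3) by blast
  note sf = deaconescu_squarefree[OF assms(1,2) M(2)]
  have p3: "3 \<le> p" if "p \<in> ?P" for p
  proof -
    have "prime p" "p dvd n" using that by (auto simp: in_prime_factors_iff)
    then have "2 \<le> p" "p \<noteq> 2" using prime_ge_2_nat sf(2) by auto
    then show ?thesis by simp
  qed
  \<comment> \<open>The primes are listed in increasing order, because the bound requires a monotone
    sequence.\<close>
  define q where "q i = sorted_list_of_set ?P ! i" for i
  have bij: "bij_betw q {..<K} ?P"
    unfolding q_def using assms(4) by (intro bij_betw_nth) auto
  have q3: "3 \<le> q i" if "i < K" for i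
    using p3 bij_betwE[OF bij] that by auto
  have prod_q: "(\<Prod>p\<in>?P. f p) = (\<Prod>i<K. f (q i))" for f :: "nat \<Rightarrow> nat"
    by (rule prod.reindex_bij_betw [OF bij, symmetric])
  have "K \<noteq> 0" using sf(1) assms(1,4) by auto
  moreover have "K \<noteq> 1"
  proof
    assume "K = 1"
    then obtain p where "?P = {p}" using assms(4) by (metis card_1_singletonE)
    then have "n = p" "prime p" using sf(1) by (auto simp: in_prime_factors_iff)
    then show False using assms(2) by simp
  qed
  ultimately obtain m where m: "K = Suc m" "1 \<le> m" by (cases K) auto
  define x where "x i = q i - 1" for i
  have x2: "2 \<le> x i" if "i < K" for i using q3[OF that] by (simp add: x_def)
  have eq: "M * (\<Prod>i<K. x i - 1) + 1 = (\<Prod>i<K. x i)"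
    using sf(3) unfolding prod_q x_def by (simp add: numeral_2_eq_2)
  \<comment> \<open>The bound is applied to the fraction \<open>1 / M\<close>.\<close>
  have "1 * (\<Prod>i<Suc m. x i) + (1 + 1) ^ 2 ^ m \<le> (1 + 1) ^ 2 ^ Suc m"
  proof (rule prod_le_of_fraction_crossing)
    show "2 \<le> x i" if "i \<le> m" for i using x2 that m by simp
    show "x i \<le> x (Suc i)" if "i < m" for i
      unfolding x_def q_def using that m assms(4)
      by (intro diff_le_mono sorted_nth_mono) auto
    show "M * (\<Prod>i<Suc m. x i - 1) \<le> 1 * (\<Prod>i<Suc m. x i)" using eq m by simp
    define P Q where "P = (\<Prod>i<m. x i)" and "Q = M * (\<Prod>i<m. x i - 1)"
    \<comment> \<open>Writing the last term as \<open>d + 1\<close> turns the equation into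
      \<open>Q * d = P * d + (P - 1)\<close>, so \<open>P \<ge> 2\<close> yields
      \<open>P < Q\<close>. That \<open>P\<close> is a nonempty product uses
      \<open>K \<ge> 2\<close>.\<close>
    obtain d where d: "x m = Suc d" "1 \<le> d" using x2[of m] m by (cases "x m") auto
    have "x 0 dvd P" using m unfolding P_def by (intro dvd_prodI) auto
    moreover have "P \<noteq> 0"
    proof -
      have "x i \<noteq> 0" if "i < m" for i using x2[of i] that m by simp
      then show ?thesis by (auto simp: P_def)
    qed
    ultimately have "2 \<le> P" using x2[of 0] m dvd_imp_le[of "x 0" P] by auto
    have "Q * d + 1 = P * Suc d" using eq d m by (simp add: P_def Q_def mult_ac)
    then have "P * d < Q * d" using \<open>2 \<le> P\<close> unfolding mult_Suc_right by linarith
    then have "P < Q" by (simp only: mult_less_cancel2)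
    then show "1 * (\<Prod>i<m. x i) < M * (\<Prod>i<m. x i - 1)" by (simp add: P_def Q_def)
  qed simp
  then have bound: "(\<Prod>i<K. x i) + 2 ^ 2 ^ m \<le> 2 ^ 2 ^ K"
    using m by (simp add: numeral_2_eq_2)
  have "n = (\<Prod>i<K. q i)" using sf(1) prod_q[of "\<lambda>p. p"] by simp
  also have "\<dots> < (\<Prod>i<K. 2 * x i)"
  proof (rule prod_mono_strict)
    have lt: "q i < 2 * x i" if "i < K" for i using q3[OF that] by (simp add: x_def)
    show "q 0 < 2 * x 0" using lt[of 0] m by simp
    show "0 \<le> q i \<and> q i \<le> 2 * x i" if "i \<in> {..<K}" for i using lt[of i] that by simp
    show "0 < 2 * x i" if "i \<in> {..<K}" for i using x2[of i] that by simp
  qed (use m in auto)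
  also have "\<dots> = 2 ^ K * (\<Prod>i<K. x i)" by (simp add: prod.distrib)
  finally have "n < 2 ^ K * (\<Prod>i<K. x i)" .
  moreover have "2 ^ K * ((\<Prod>i<K. x i) + 2 ^ 2 ^ m) \<le> 2 ^ K * 2 ^ 2 ^ K"
    using bound by (intro mult_left_mono) auto
  ultimately have "n + 2 ^ K * 2 ^ 2 ^ m < 2 ^ K * 2 ^ 2 ^ K"
    unfolding distrib_left by linarith
  then have "real (n + 2 ^ K * 2 ^ 2 ^ m) < real (2 ^ K * 2 ^ 2 ^ K)"
    by (simp only: of_nat_less_iff)
  then show ?thesis using m by (simp add: power_add mult_ac)
qed

end
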